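(* Let $\dot{\mathbf{x}}=\mathbf{f}(\mathbf{x})$ be a dynamical system with $\mathbf{x}\in\mathbb{R}^n$ whose trajectories remain bounded as $t\to\infty$, let $\varphi(\mathbf{x})$ be a scalar function, let $\overline{\varphi}$ be its infinite-time average along a trajectory, and let $\mathcal{T}\subset\mathbb{R}^n$ be an absorbing domain. If there exist differentiable functions $V_u,V_l:\mathbb{R}^n\to\mathbb{R}$ and constants $U,L\in\mathbb{R}$ such that $$\mathbf{f}\cdot\nabla V_u+\varphi-U\le 0\quad\forall\,\mathbf{x}\in\mathcal{T},\qquad \mathbf{f}\cdot\nabla V_l+\varphi-L\ge 0\quad\forall\,\mathbf{x}\in\mathcal{T},$$ then along any trajectory $\mathbf{x}(t)$ that permanently enters $\mathcal{T}$, $$L\le\overline{\varphi}\le U.$$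
   Context: For a trajectory $\mathbf{x}(t)$ of the autonomous system $\dot{\mathbf{x}}=\mathbf{f}(\mathbf{x})$, the time average is $$\overline{\varphi}:=\lim_{T\to\infty}\frac1T\int_0^T\varphi[\mathbf{x}(t)]\,dt,$$ and its existence is assumed; if the limit does not exist, it is replaced by the limit superior for the upper bound and by the limit inferior for the lower bound. Its value may depend on the trajectory. A trajectory permanently enters $\mathcal{T}$ if there is a time $t_0$ such that $\mathbf{x}(t)\in\mathcal{T}$ for all $t\ge t_0$. An absorbing domain is a set $\mathcal{T}$ that trajectories of interest eventually enter and then remain inside; the conclusion concerns only trajectories that permanently enter $\mathcal{T}$. *)

theory Defs
  imports "HOL-Analysis.Analysis"
begin

text \<open>Only the values at times \<open>t \<ge> 0\<close> matter; the derivative at \<open>0\<close> is one-sided.\<close>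

definition trajectory :: "(real^'n \<Rightarrow> real^'n) \<Rightarrow> (real \<Rightarrow> real^'n) \<Rightarrow> bool" where
  "trajectory f x \<longleftrightarrow> (\<forall>t\<ge>0. (x has_vector_derivative f (x t)) (at t within {0..}))"

definition bounded_trajectories :: "(real^'n \<Rightarrow> real^'n) \<Rightarrow> bool" where
  "bounded_trajectories f \<longleftrightarrow> (\<forall>x. trajectory f x \<longrightarrow> Bfun x at_top)"

definition permanently_enters :: "(real \<Rightarrow> real^'n) \<Rightarrow> (real^'n) set \<Rightarrow> bool" where
  "permanently_enters x T \<longleftrightarrow> (\<exists>t0\<ge>0. \<forall>t\<ge>t0. x t \<in> T)"

text \<open>Absorption is relative to a class \<open>X\<close> of trajectories of interest: it is not required that
  every trajectory of the system is eventually absorbed.\<close>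

definition absorbing_domain ::
    "(real^'n \<Rightarrow> real^'n) \<Rightarrow> (real \<Rightarrow> real^'n) set \<Rightarrow> (real^'n) set \<Rightarrow> bool" where
  "absorbing_domain f X T \<longleftrightarrow> (\<forall>x\<in>X. trajectory f x \<and> permanently_enters x T)"

definition gradient :: "(real^'n \<Rightarrow> real) \<Rightarrow> real^'n \<Rightarrow> real^'n" where
  "gradient V y = (THE D. GDERIV V y :> D)"

lemma gradient_eqI:
  assumes "GDERIV V y :> D"
  shows "gradient V y = D"
  unfolding gradient_def
proof (rule the_equality)
  show "GDERIV V y :> D" by fact
  fix E assume "GDERIV V y :> E"
  then have "(\<lambda>h. h \<bullet> E) = (\<lambda>h. h \<bullet> D)"
    using assms unfolding gderiv_def by (rule has_derivative_unique)
  then have "h \<bullet> E = h \<bullet> D" for h by (rule fun_cong)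
  then show "E = D" by (metis vector_eq_ldot)
qed

lemma GDERIV_gradient:
  assumes "V differentiable (at y)"
  shows "GDERIV V y :> gradient V y"
proof -
  obtain A where A: "(V has_derivative A) (at y)"
    using assms unfolding differentiable_def by blast
  have "A h = h \<bullet> adjoint A 1" for h
    using adjoint_works[OF has_derivative_linear[OF A], of h 1] by simp
  then have "A = (\<lambda>h. h \<bullet> adjoint A 1)" by (rule ext)
  then have "GDERIV V y :> adjoint A 1"
    unfolding gderiv_def using A by (simp only:)
  then show ?thesis
    by (simp only: gradient_eqI)
qed

text \<open>The integral is the Henstock-Kurzweil integral, which extends the Lebesgue integral.\<close>

definition finite_time_average ::
    "(real^'n \<Rightarrow> real) \<Rightarrow> (real \<Rightarrow> real^'n) \<Rightarrow> real \<Rightarrow> real" where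
  "finite_time_average \<phi> x \<tau> = (1 / \<tau>) * integral {0..\<tau>} (\<lambda>t. \<phi> (x t))"

definition has_time_average ::
    "(real^'n \<Rightarrow> real) \<Rightarrow> (real \<Rightarrow> real^'n) \<Rightarrow> real \<Rightarrow> bool" where
  "has_time_average \<phi> x a \<longleftrightarrow> (finite_time_average \<phi> x \<longlongrightarrow> a) at_top"

definition upper_time_average ::
    "(real^'n \<Rightarrow> real) \<Rightarrow> (real \<Rightarrow> real^'n) \<Rightarrow> ereal" where
  "upper_time_average \<phi> x = Limsup at_top (\<lambda>\<tau>. ereal (finite_time_average \<phi> x \<tau>))"

definition lower_time_average ::
    "(real^'n \<Rightarrow> real) \<Rightarrow> (real \<Rightarrow> real^'n) \<Rightarrow> ereal" where
  "lower_time_average \<phi> x = Liminf at_top (\<lambda>\<tau>. ereal (finite_time_average \<phi> x \<tau>))"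

end

theory Submission
  imports Defs
begin

text \<open>
  The function \<open>V\<close> is an auxiliary function whose derivative along the flow averages to zero.
  By the chain rule, \<open>t \<mapsto> V (x t)\<close> has derivative \<open>f (x t) \<bullet> \<nabla>V (x t)\<close>, so the integral of this
  derivative over \<open>[t0, \<tau>]\<close> is \<open>V (x \<tau>) - V (x t0)\<close>. The trajectory is bounded and \<open>V\<close> is
  continuous, so this difference stays bounded while \<open>\<tau>\<close> grows; dividing by \<open>\<tau>\<close> makes it vanish.
  Adding \<open>f \<bullet> \<nabla>V\<close> to \<open>\<phi>\<close> therefore does not change the infinite-time average, and a pointwise bound
  on the sum over \<open>T\<close> becomes a bound on the average of \<open>\<phi>\<close>. The time before the trajectory settles
  in \<open>T\<close> contributes a constant to the integral and is lost in the limit as well.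

  The quantitative form is \<open>finite_time_average_le\<close>: for large \<open>\<tau>\<close>, the average up to
  time \<open>\<tau>\<close> exceeds \<open>U\<close> by at most \<open>C / \<tau>\<close>. The lower bound is the upper bound for \<open>- \<phi>\<close>, \<open>- V\<close> and \<open>- L\<close>.
\<close>

lemma has_vector_derivative_along_trajectory:
  fixes V :: "real^'n \<Rightarrow> real"
  assumes traj: "trajectory f x" and V: "GDERIV V (x t) :> G" and "t \<ge> 0"
  shows "((\<lambda>s. V (x s)) has_vector_derivative f (x t) \<bullet> G) (at t within {0..})"
proof -
  have "(x has_derivative (\<lambda>h. h *\<^sub>R f (x t))) (at t within {0..})"
    using traj \<open>t \<ge> 0\<close> by (simp add: trajectory_def has_vector_derivative_def)
  moreover have "(V has_derivative (\<lambda>h. h \<bullet> G)) (at (x t))"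
    using V by (simp add: gderiv_def)
  ultimately show ?thesis
    unfolding has_vector_derivative_def by (auto dest: has_derivative_compose)
qed

lemma bounded_along_trajectory:
  fixes x :: "real \<Rightarrow> real^'n" and V :: "real^'n \<Rightarrow> real"
  assumes "Bfun x at_top" and "continuous_on UNIV V"
  obtains B where "\<forall>\<^sub>F t in at_top. \<bar>V (x t)\<bar> \<le> B"
proof -
  obtain K where K: "\<forall>\<^sub>F t in at_top. norm (x t) \<le> K"
    using assms(1) by (auto elim: BfunE)
  have "compact (V ` cball 0 K)"
    by (intro compact_continuous_image compact_cball continuous_on_subset[OF assms(2)]) auto
  then obtain B where "\<forall>v\<in>V ` cball 0 K. norm v \<le> B"
    using compact_imp_bounded bounded_iff by metis
  then have "\<forall>\<^sub>F t in at_top. \<bar>V (x t)\<bar> \<le> B"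
    using K by (auto elim!: eventually_mono)
  then show thesis by (rule that)
qed

text \<open>
  Over \<open>[t0, \<tau>]\<close> the integrand \<open>\<phi>\<close> is at most \<open>U - f \<bullet> \<nabla>V\<close>, whose integral is
  \<open>U * (\<tau> - t0) + V (x t0) - V (x \<tau>)\<close>. The fundamental theorem of calculus for the
  Henstock-Kurzweil integral makes the possibly discontinuous function \<open>f \<bullet> \<nabla>V\<close> integrable along
  the trajectory, because it is a derivative there.
\<close>

lemma finite_time_average_le:
  fixes \<phi> V :: "real^'n \<Rightarrow> real"
  assumes traj: "trajectory f x" and bdd: "Bfun x at_top"
    and V: "\<And>y. GDERIV V y :> G y"
    and le: "\<And>y. y \<in> T \<Longrightarrow> f y \<bullet> G y + \<phi> y \<le> U"
    and enters: "permanently_enters x T"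
    and int: "\<And>\<tau>. \<tau> \<ge> 0 \<Longrightarrow> (\<lambda>t. \<phi> (x t)) integrable_on {0..\<tau>}"
  obtains C where "\<forall>\<^sub>F \<tau> in at_top. finite_time_average \<phi> x \<tau> \<le> U + C / \<tau>"
proof -
  obtain t0 where t0: "t0 \<ge> 0" "\<And>t. t \<ge> t0 \<Longrightarrow> x t \<in> T"
    using enters by (auto simp: permanently_enters_def)
  have "continuous_on UNIV V"
    using V unfolding gderiv_def
    by (intro has_derivative_continuous_on) (blast intro: has_derivative_at_withinI)
  then obtain B where B: "\<forall>\<^sub>F t in at_top. \<bar>V (x t)\<bar> \<le> B"
    using bounded_along_trajectory[OF bdd] by blast
  define C where "C = integral {0..t0} (\<lambda>t. \<phi> (x t)) - U * t0 + V (x t0) + B"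
  have average: "finite_time_average \<phi> x \<tau> \<le> U + C / \<tau>"
    if \<tau>: "\<tau> > 0" "\<tau> \<ge> t0" and bound: "\<bar>V (x \<tau>)\<bar> \<le> B" for \<tau>
  proof -
    have "((\<lambda>t. f (x t) \<bullet> G (x t)) has_integral V (x \<tau>) - V (x t0)) {t0..\<tau>}"
      using t0(1) \<tau>(2)
      by (intro fundamental_theorem_of_calculus
            has_vector_derivative_within_subset[OF has_vector_derivative_along_trajectory[OF traj V]])
        auto
    then have "((\<lambda>t. U - f (x t) \<bullet> G (x t)) has_integral
        U * (\<tau> - t0) - (V (x \<tau>) - V (x t0))) {t0..\<tau>}"
      using has_integral_diff[OF has_integral_const_real[of U t0 \<tau>]] \<tau>(2)
      by (simp add: mult.commute)
    moreover have "((\<lambda>t. \<phi> (x t)) has_integral integral {t0..\<tau>} (\<lambda>t. \<phi> (x t))) {t0..\<tau>}"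
      using int[of \<tau>] \<tau> t0(1)
      by (intro integrable_integral) (rule integrable_on_subinterval, auto)
    ultimately have "integral {t0..\<tau>} (\<lambda>t. \<phi> (x t)) \<le> U * (\<tau> - t0) - (V (x \<tau>) - V (x t0))"
      using le t0(2) by (elim has_integral_le[rotated]) (force simp: algebra_simps)+
    moreover have "integral {0..\<tau>} (\<lambda>t. \<phi> (x t))
        = integral {0..t0} (\<lambda>t. \<phi> (x t)) + integral {t0..\<tau>} (\<lambda>t. \<phi> (x t))"
      using Henstock_Kurzweil_Integration.integral_combine[OF t0(1) \<tau>(2) int] \<tau>(1) by simp
    ultimately have "integral {0..\<tau>} (\<lambda>t. \<phi> (x t)) \<le> U * \<tau> + C"
      using bound by (simp add: C_def algebra_simps)
    then show ?thesis
      using \<tau>(1) by (simp add: finite_time_average_def field_simps)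
  qed
  have "\<forall>\<^sub>F \<tau> in at_top. finite_time_average \<phi> x \<tau> \<le> U + C / \<tau>"
    using B eventually_gt_at_top[of 0] eventually_ge_at_top[of t0]
    by eventually_elim (rule average)
  then show thesis by (rule that)
qed

lemma upper_time_average_le:
  fixes \<phi> V :: "real^'n \<Rightarrow> real"
  assumes "trajectory f x" and "Bfun x at_top"
    and "\<And>y. GDERIV V y :> G y"
    and "\<And>y. y \<in> T \<Longrightarrow> f y \<bullet> G y + \<phi> y \<le> U"
    and "permanently_enters x T"
    and "\<And>\<tau>. \<tau> \<ge> 0 \<Longrightarrow> (\<lambda>t. \<phi> (x t)) integrable_on {0..\<tau>}"
  shows "upper_time_average \<phi> x \<le> ereal U"
proof -
  obtain C where C: "\<forall>\<^sub>F \<tau> in at_top. finite_time_average \<phi> x \<tau> \<le> U + C / \<tau>"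
    using finite_time_average_le[OF assms] by blast
  have "((\<lambda>\<tau>. U + C / \<tau>) \<longlongrightarrow> U + 0) at_top"
    by (intro tendsto_intros tendsto_divide_0[OF tendsto_const] filterlim_at_top_imp_at_infinity
        filterlim_ident)
  then have "Limsup at_top (\<lambda>\<tau>. ereal (U + C / \<tau>)) = ereal U"
    by (intro lim_imp_Limsup) (auto simp del: plus_ereal.simps)
  moreover have "upper_time_average \<phi> x \<le> Limsup at_top (\<lambda>\<tau>. ereal (U + C / \<tau>))"
    unfolding upper_time_average_def using C by (intro Limsup_mono) (auto elim: eventually_mono)
  ultimately show ?thesis by simp
qed

lemma upper_time_average_uminus:
  "upper_time_average (\<lambda>y. - \<phi> y) x = - lower_time_average \<phi> x"
proof -
  have "ereal (finite_time_average (\<lambda>y. - \<phi> y) x \<tau>) = - ereal (finite_time_average \<phi> x \<tau>)" for \<tau>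
    by (simp add: finite_time_average_def)
  then show ?thesis
    by (simp add: upper_time_average_def lower_time_average_def ereal_Limsup_uminus
        del: uminus_ereal.simps)
qed

lemma has_time_average_imp_upper_lower:
  assumes "has_time_average \<phi> x a"
  shows "upper_time_average \<phi> x = ereal a" and "lower_time_average \<phi> x = ereal a"
  using assms
  by (auto simp: has_time_average_def upper_time_average_def lower_time_average_def
      intro!: lim_imp_Limsup lim_imp_Liminf)

theorem proposition2:
  fixes f :: "real^'n \<Rightarrow> real^'n"
    and \<phi> V_u V_l :: "real^'n \<Rightarrow> real"
    and U L :: real
    and T :: "(real^'n) set"
    and X :: "(real \<Rightarrow> real^'n) set"
    and x :: "real \<Rightarrow> real^'n"
  assumes "bounded_trajectories f"
    and "absorbing_domain f X T"
    and "\<forall>y. V_u differentiable (at y)"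
    and "\<forall>y. V_l differentiable (at y)"
    and "\<forall>y\<in>T. f y \<bullet> gradient V_u y + \<phi> y - U \<le> 0"
    and "\<forall>y\<in>T. f y \<bullet> gradient V_l y + \<phi> y - L \<ge> 0"
    and "trajectory f x"
    and "permanently_enters x T"
    and "\<forall>\<tau>\<ge>0. (\<lambda>t. \<phi> (x t)) integrable_on {0..\<tau>}"
  shows "(\<forall>a. has_time_average \<phi> x a \<longrightarrow> L \<le> a \<and> a \<le> U)
    \<and> ereal L \<le> lower_time_average \<phi> x
    \<and> upper_time_average \<phi> x \<le> ereal U"
proof -
  have bdd: "Bfun x at_top"
    using assms(1,7) by (simp add: bounded_trajectories_def)
  have upper: "upper_time_average \<phi> x \<le> ereal U"
    using assms(3,5,8,9)
    by (intro upper_time_average_le[OF assms(7) bdd, where V = V_u and G = "gradient V_u"])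
      (auto intro: GDERIV_gradient simp: algebra_simps)
  have "upper_time_average (\<lambda>y. - \<phi> y) x \<le> ereal (- L)"
  proof (rule upper_time_average_le[OF assms(7) bdd])
    show "GDERIV (\<lambda>y. - V_l y) y :> - gradient V_l y" for y
      using assms(4) by (intro GDERIV_minus GDERIV_gradient) auto
    show "f y \<bullet> (- gradient V_l y) + - \<phi> y \<le> - L" if "y \<in> T" for y
      using assms(6) that by (force simp: algebra_simps)
    show "permanently_enters x T" by fact
    show "(\<lambda>t. - \<phi> (x t)) integrable_on {0..\<tau>}" if "\<tau> \<ge> 0" for \<tau>
      using assms(9) that by (intro integrable_neg) auto
  qed
  then have lower: "ereal L \<le> lower_time_average \<phi> x"
    by (simp add: upper_time_average_uminus ereal_minus_le_minus
        flip: uminus_ereal.simps(1))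
  have "L \<le> a \<and> a \<le> U" if "has_time_average \<phi> x a" for a
    using upper lower has_time_average_imp_upper_lower[OF that] by simp
  then show ?thesis
    using upper lower by blast
qed

end
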